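(* Let $m=p^s$ be a prime power with $p$ prime and $s\geq 3$, and let $k=p^{s-2}+1$. Then there exist constants $C_m>0$ and $0< c_m \leq m/2$ (depending only on $m$) such that for all integers $n\ge 1$ $$r_k(\mathbb{Z}_m^n)\geq C_m \frac{(m-2p^2+2p)^n}{n^{c_m}}.$$
   Context: $\mathbb{Z}_m^n$ denotes the additive group $(\mathbb{Z}/m\mathbb{Z})^n$. A proper arithmetic progression of length $k$ in $\mathbb{Z}_m^n$ is a sequence $x, x+d, \ldots, x+(k-1)d$ (with $x,d\in\mathbb{Z}_m^n$) whose $k$ elements are pairwise distinct. $r_k(\mathbb{Z}_m^n)$ denotes the maximal size of a set $S\subseteq\mathbb{Z}_m^n$ that does not contain a proper arithmetic progression of length $k$. *)

theory Defs
  imports Complex_Main "HOL-Computational_Algebra.Primes"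
    "HOL-Algebra.Elementary_Groups" "HOL-Algebra.Product_Groups"
begin

text \<open>
  The additive group $(\mathbb{Z}/m\mathbb{Z})^n$. Elements are extensional functions on
  \<open>{..<n}\<close> with values in \<open>{0..<int m}\<close> (for \<open>m > 0\<close>). The group operation, addition modulo \<open>m\<close> in each
  coordinate, is written multiplicatively, following the library convention.
\<close>

definition Zmod_power :: "nat \<Rightarrow> nat \<Rightarrow> (nat \<Rightarrow> int) monoid" where
  "Zmod_power m n = product_group {..<n} (\<lambda>_. integer_mod_group m)"

text \<open>
  In an additive group, \<open>progression G x d i\<close> is the term \<open>x + i d\<close>; the powers below are
  multiples of \<open>d\<close> in additive notation.
\<close>

definition progression :: "('a, 'b) monoid_scheme \<Rightarrow> 'a \<Rightarrow> 'a \<Rightarrow> nat \<Rightarrow> 'a" where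
  "progression G x d i = x \<otimes>\<^bsub>G\<^esub> d [^]\<^bsub>G\<^esub> i"

definition contains_proper_AP :: "('a, 'b) monoid_scheme \<Rightarrow> nat \<Rightarrow> 'a set \<Rightarrow> bool" where
  "contains_proper_AP G k S \<longleftrightarrow>
     (\<exists>x \<in> carrier G. \<exists>d \<in> carrier G.
        inj_on (progression G x d) {..<k} \<and> progression G x d ` {..<k} \<subseteq> S)"

text \<open>
  Only meaningful for finite \<open>G\<close> and \<open>k \<ge> 1\<close>, where the maximum is over a finite nonempty set
  (the empty set is always admissible).
\<close>

definition r_AP :: "nat \<Rightarrow> ('a, 'b) monoid_scheme \<Rightarrow> nat" where
  "r_AP k G = Max {card S | S. S \<subseteq> carrier G \<and> \<not> contains_proper_AP G k S}"

end

theory Submission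
  imports Defs "HOL-Number_Theory.Cong"
begin

text \<open>
  Let \<open>q = p^(s-2)\<close> and delete from \<open>\<int>/m\<close> the nonzero multiples of \<open>q\<close> and, for \<open>0 < r < p\<close>, the
  residues other than \<open>r\<close> that are congruent to \<open>r\<close> modulo \<open>p^(s-1)\<close>. This deletes
  \<open>(p^2 - 1) + (p - 1)^2 = 2p^2 - 2p\<close> letters. Consider a progression of length \<open>q + 1\<close> in a power of the
  remaining alphabet. In a coordinate that starts at \<open>0\<close> the difference vanishes, since otherwise the
  coordinate reaches a nonzero multiple of \<open>q\<close>; a coordinate whose difference is prime to \<open>p\<close>
  meets the multiples of \<open>q\<close>, hence \<open>0\<close>. So if all terms have equally many zero coordinates, all
  differences are divisible by \<open>p\<close>. The same comparison for the letters below \<open>p\<close> then shows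
  that all differences are divisible by \<open>p^2\<close>, so that the first and the last term coincide. The words
  in which both counts are prescribed therefore contain no proper progression, and some choice of
  the two counts is attained by at least a proportion \<open>1 / (n + 1)^2\<close> of all words.
\<close>

section \<open>The alphabet and its size\<close>

definition letters :: "nat \<Rightarrow> nat \<Rightarrow> int set" where
  "letters p s = {y \<in> {0..<int p ^ s}.
     (int p ^ (s - 2) dvd y \<longrightarrow> y = 0) \<and> (y mod int p ^ (s - 1) < int p \<longrightarrow> y < int p)}"

lemma letters_subset: "letters p s \<subseteq> {0..<int p ^ s}"
  by (auto simp: letters_def)

lemma finite_letters: "finite (letters p s)"
  by (rule finite_subset[OF letters_subset]) simp

lemma lettersD:
  assumes "y \<in> letters p s"
  shows "0 \<le> y" "y < int p ^ s" "int p ^ (s - 2) dvd y \<Longrightarrow> y = 0"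
    "y mod int p ^ (s - 1) < int p \<Longrightarrow> y < int p"
  using assms by (auto simp: letters_def)

text \<open>The deleted letters are covered by \<open>A \<union> B\<close>; an upper bound on the
  sizes of these two images suffices.\<close>

lemma card_letters_ge:
  assumes "p \<ge> 2" "s \<ge> 3"
  shows "real (card (letters p s)) \<ge> real p ^ s - 2 * real p ^ 2 + 2 * real p"
proof -
  define P where "P = int p"
  have P2: "P \<ge> 2" using assms by (simp add: P_def)
  define q where "q = P ^ (s - 2)"
  define M where "M = P ^ (s - 1)"
  have qpos: "q > 0" and Mpos: "M > 0" using P2 by (auto simp: q_def M_def)
  have "s = s - 2 + 2" using assms by simp
  then have m1: "P ^ s = q * P\<^sup>2" unfolding q_def by (metis power_add)
  have "s = s - 1 + 1" using assms by simp
  then have m2: "P ^ s = M * P" unfolding M_def by (metis power_add power_one_right)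
  \<comment> \<open>The ranges of \<open>t\<close> come from
    \<open>P ^ s = q * P\<^sup>2 = M * P\<close>. In \<open>B\<close>, \<open>t = 0\<close> is left
    out because the letters \<open>r\<close> with \<open>0 < r < P\<close> are kept, and
    \<open>r = 0\<close> because it gives multiples of \<open>q\<close>.\<close>
  define A where "A = (\<lambda>t. t * q) ` {1..<P\<^sup>2}"
  define B where "B = (\<lambda>(r, t). r + t * M) ` ({1..<P} \<times> {1..<P})"
  have sub: "{0..<P ^ s} \<subseteq> letters p s \<union> (A \<union> B)"
  proof
    fix y assume y: "y \<in> {0..<P ^ s}"
    show "y \<in> letters p s \<union> (A \<union> B)"
    proof (cases "q dvd y")
      case True
      then obtain t where t: "y = t * q" by (metis dvdE mult.commute)
      show ?thesis
      proof (cases "y = 0")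
        case True
        then show ?thesis using P2 by (auto simp: letters_def P_def)
      next
        case False
        have "t > 0" using False t y qpos
          by (metis atLeastLessThan_iff less_le mult_eq_0_iff zero_le_mult_iff not_less)
        moreover have "t < P\<^sup>2" using t y m1 qpos by (simp add: mult.commute)
        ultimately show ?thesis using t by (auto simp: A_def)
      qed
    next
      case False
      show ?thesis
      proof (cases "y mod M < P \<and> \<not> y < P")
        case True
        have dv: "q dvd M" unfolding q_def M_def by (intro le_imp_power_dvd) simp
        have "y mod M \<noteq> 0" using False dv by (meson dvd_eq_mod_eq_0 dvd_trans)
        moreover have "y mod M \<ge> 0" using Mpos by simp
        moreover have "y div M \<noteq> 0"
        proof
          assume "y div M = 0"
          then have "y mod M = y" using div_mult_mod_eq[of y M] by simp
          then show False using True by simp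
        qed
        moreover have "y div M \<ge> 0" using Mpos y by (simp add: pos_imp_zdiv_nonneg_iff)
        moreover have "y div M < P"
        proof -
          have "M * (y div M) \<le> y" using Mpos by (simp add: minus_mod_eq_mult_div[symmetric])
          also have "y < M * P" using y m2 by simp
          finally show ?thesis using Mpos by simp
        qed
        ultimately have "(y mod M, y div M) \<in> {1..<P} \<times> {1..<P}" using True by auto
        moreover have "y = y mod M + y div M * M" by simp
        ultimately have "y \<in> B" unfolding B_def by force
        then show ?thesis by simp
      qed (use y False in \<open>auto simp: letters_def P_def q_def M_def\<close>)
    qed
  qed
  have cA: "card A \<le> nat (P\<^sup>2 - 1)"
    unfolding A_def by (rule order_trans[OF card_image_le]) auto
  have cB: "card B \<le> nat (P - 1) * nat (P - 1)"
    unfolding B_def by (rule order_trans[OF card_image_le]) (auto simp: card_cartesian_product)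
  have "card {0..<P ^ s} \<le> card (letters p s \<union> (A \<union> B))"
    using sub finite_letters by (intro card_mono) (auto simp: A_def B_def)
  also have "\<dots> \<le> card (letters p s) + (card A + card B)"
    by (meson card_Un_le le_trans add_left_mono)
  finally have "nat (P ^ s) \<le> card (letters p s) + (nat (P\<^sup>2 - 1) + nat (P - 1) * nat (P - 1))"
    using cA cB by simp
  then have "real (nat (P ^ s))
      \<le> real (card (letters p s) + (nat (P\<^sup>2 - 1) + nat (P - 1) * nat (P - 1)))"
    by (rule of_nat_mono)
  moreover have "P\<^sup>2 \<ge> 1" using P2 by simp
  ultimately have "real_of_int (P ^ s)
      \<le> real (card (letters p s)) + (real_of_int (P\<^sup>2 - 1) + real_of_int (P - 1) * real_of_int (P - 1))"
    using P2 by (simp add: of_nat_nat)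
  then show ?thesis by (simp add: P_def power2_eq_square algebra_simps)
qed

section \<open>Residues reached by multiples of a difference\<close>

text \<open>Take the last of \<open>d\<close>, \<open>P * d\<close>, ..., \<open>P ^ l * d\<close>
  that is nonzero modulo \<open>P ^ s\<close>. If it precedes \<open>P ^ l * d\<close>, one more
  factor \<open>P\<close> gives zero, so it is already divisible by
  \<open>P ^ (s - 1)\<close>.\<close>

lemma exists_last_nonzero_multiple:
  fixes P d :: int
  assumes "P \<noteq> 0" "\<not> P ^ s dvd d"
  shows "\<exists>i\<le>l. \<not> P ^ s dvd P ^ i * d \<and> (i = l \<or> P ^ (s - 1) dvd P ^ i * d)"
proof (cases "P ^ s dvd P ^ l * d")
  case True
  define j where "j = (LEAST j. P ^ s dvd P ^ j * d)"
  have j: "P ^ s dvd P ^ j * d" "j \<le> l"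
    unfolding j_def using True by (auto intro: LeastI Least_le)
  with assms have "j \<noteq> 0" "s \<noteq> 0" by (auto intro: ccontr)
  then obtain i t where it: "j = Suc i" "s = Suc t" by (meson not0_implies_Suc)
  have "\<not> P ^ s dvd P ^ i * d"
    using not_less_Least[of i "\<lambda>j. P ^ s dvd P ^ j * d"] it(1) unfolding j_def by simp
  moreover have "P ^ (s - 1) dvd P ^ i * d" using j(1) it assms(1) by (simp add: mult.assoc)
  ultimately show ?thesis using j(2) it(1) by (intro exI[of _ i]) auto
qed blast

text \<open>As \<open>d\<close> is invertible modulo \<open>N\<close>, \<open>N\<close> consecutive
  terms run through all classes modulo \<open>N\<close>.\<close>

lemma coprime_hits_class:
  fixes x d N :: int
  assumes "coprime d N" "N > 0"
  shows "\<exists>j. int j < N \<and> N dvd x + int j * d"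
proof -
  obtain e where e: "[d * e = 1] (mod N)" using cong_solve_coprime_int assms(1) by blast
  let ?j = "nat ((- x * e) mod N)"
  have j: "int ?j = (- x * e) mod N" "int ?j < N" using assms(2) by auto
  have "[x + int ?j * d = x + (- x * e) * d] (mod N)"
    unfolding j(1) by (intro cong_add cong_mult) (auto simp: cong_def)
  also have "[x + (- x * e) * d = x + (- x) * (d * e)] (mod N)" by (simp add: ac_simps)
  also have "[x + (- x) * (d * e) = x + (- x) * 1] (mod N)" by (intro cong_add cong_mult e) auto
  finally have "N dvd x + int ?j * d" by (simp add: cong_0_iff)
  with j(2) show ?thesis by blast
qed

section \<open>One coordinate of a progression of length \<open>p ^ (s - 2) + 1\<close> with terms
  in \<open>letters p s\<close>\<close>

context
  fixes p s :: nat and y d :: int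
  assumes p: "prime p" and s: "s \<ge> 3"
    and letters: "\<And>j. j \<le> p ^ (s - 2) \<Longrightarrow> (y + int j * d) mod int p ^ s \<in> letters p s"
begin

text \<open>For a nonzero difference, its last nonzero multiple by a power of \<open>p\<close> up to
  \<open>p ^ (s - 2)\<close> would be a term of the coordinate and a nonzero multiple of
  \<open>p ^ (s - 2)\<close>, which is no letter.\<close>

lemma zero_start_imp_dvd:
  assumes "y = 0"
  shows "int p ^ s dvd d"
proof (rule ccontr)
  assume nd: "\<not> int p ^ s dvd d"
  have "int p \<noteq> 0" using p by (metis not_prime_0 of_nat_eq_0_iff)
  \<comment> \<open>The bound \<open>s - 2\<close> keeps the index \<open>p ^ i\<close> within the
    progression; the case \<open>i = s - 2\<close> uses its very last term.\<close>
  from exists_last_nonzero_multiple[OF this nd, of "s - 2"] obtain i where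
    i: "i \<le> s - 2" "\<not> int p ^ s dvd int p ^ i * d"
      "i = s - 2 \<or> int p ^ (s - 1) dvd int p ^ i * d" by blast
  have "p ^ i \<le> p ^ (s - 2)" using i(1) p by (simp add: power_increasing prime_gt_0_nat Suc_leI)
  from letters[OF this] have L: "(int p ^ i * d) mod int p ^ s \<in> letters p s"
    using assms by simp
  have "int p ^ (s - 2) dvd int p ^ (s - 1)" by (intro le_imp_power_dvd) simp
  then have "int p ^ (s - 2) dvd int p ^ i * d" using i(3) dvd_trans by auto
  moreover have "int p ^ (s - 2) dvd int p ^ s" by (intro le_imp_power_dvd) simp
  ultimately have "int p ^ (s - 2) dvd (int p ^ i * d) mod int p ^ s" by (simp add: dvd_mod)
  from lettersD(3)[OF L this] i(2) show False by (simp add: dvd_eq_mod_eq_0)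
qed

text \<open>The same multiple, added to \<open>y\<close>, gives a term that differs from
  \<open>y\<close> but agrees with it modulo \<open>p ^ (s - 1)\<close>. The only letter in that
  class is \<open>y\<close> itself.\<close>

lemma small_start_imp_dvd:
  assumes "0 \<le> y" "y < int p" "int p dvd d"
  shows "int p ^ s dvd d"
proof (rule ccontr)
  assume nd: "\<not> int p ^ s dvd d"
  have "int p > 0" using p by (simp add: prime_gt_0_nat)
  then have "int p \<noteq> 0" by simp
  from exists_last_nonzero_multiple[OF this nd, of "s - 2"] obtain i where
    i: "i \<le> s - 2" "\<not> int p ^ s dvd int p ^ i * d"
      "i = s - 2 \<or> int p ^ (s - 1) dvd int p ^ i * d" by blast
  have "p ^ i \<le> p ^ (s - 2)" using i(1) p by (simp add: power_increasing prime_gt_0_nat Suc_leI)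
  from letters[OF this] have L: "(y + int p ^ i * d) mod int p ^ s \<in> letters p s" (is "?z \<in> _")
    by simp
  \<comment> \<open>If \<open>i = s - 2\<close>, the factor \<open>p\<close> still lacking for
    \<open>p ^ (s - 1)\<close> is supplied by \<open>d\<close>.\<close>
  have "s - 1 = Suc (s - 2)" using s by simp
  then have "int p ^ (s - 1) = int p ^ (s - 2) * int p" by simp
  then have "int p ^ (s - 1) dvd int p ^ (s - 2) * d" using assms(3) by (simp add: mult_dvd_mono)
  then have dv: "int p ^ (s - 1) dvd int p ^ i * d" using i(3) by auto
  have dvs: "int p ^ (s - 1) dvd int p ^ s" by (intro le_imp_power_dvd) simp
  have "int p ^ 1 \<le> int p ^ (s - 1)" "int p ^ 1 \<le> int p ^ s"
    using s \<open>int p > 0\<close> by (intro power_increasing; simp)+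
  then have le: "y < int p ^ (s - 1)" "y < int p ^ s" "int p \<le> int p ^ (s - 1)"
    using assms(2) unfolding power_one_right by linarith+
  have "?z mod int p ^ (s - 1) = (y + int p ^ i * d) mod int p ^ (s - 1)"
    using dvs by (simp add: mod_mod_cancel)
  also have "\<dots> = y mod int p ^ (s - 1)" using dv by (metis dvdE mod_mult_self2)
  also have "\<dots> = y" using assms(1) le by (intro mod_pos_pos_trivial)
  finally have eq: "?z mod int p ^ (s - 1) = y" .
  then have "?z < int p" using lettersD(4)[OF L] assms by simp
  moreover have "?z \<ge> 0" using lettersD(1)[OF L] .
  ultimately have "?z mod int p ^ (s - 1) = ?z" using le(3) by (intro mod_pos_pos_trivial) linarith+
  with eq have z: "?z = y" by (rule trans[OF sym, rotated])
  have "y mod int p ^ s = y" using assms(1) le(2) by (rule mod_pos_pos_trivial)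
  with z have "(y + int p ^ i * d) mod int p ^ s = y mod int p ^ s" by (simp only:)
  then have "int p ^ s dvd int p ^ i * d" by (simp add: mod_eq_dvd_iff)
  with i(2) show False by simp
qed

text \<open>The terms with index below \<open>p ^ (s - 2)\<close> meet every class modulo
  \<open>p ^ (s - 2)\<close>, and the only letter in the class of \<open>0\<close> is
  \<open>0\<close>.\<close>

lemma unit_difference_hits_zero:
  assumes "\<not> int p dvd d"
  shows "\<exists>j\<le>p ^ (s - 2). (y + int j * d) mod int p ^ s = 0"
proof -
  have "coprime (int p) d" using assms p by (intro prime_imp_coprime) auto
  then have "coprime d (int p ^ (s - 2))" by (simp add: coprime_commute)
  moreover have "int p ^ (s - 2) > 0" using p by (simp add: prime_gt_0_nat)
  ultimately obtain j where j: "int j < int p ^ (s - 2)" "int p ^ (s - 2) dvd y + int j * d"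
    using coprime_hits_class by blast
  have jle: "j \<le> p ^ (s - 2)" using j(1) by (metis less_imp_le of_nat_less_iff of_nat_power)
  have "int p ^ (s - 2) dvd int p ^ s" by (intro le_imp_power_dvd) simp
  then have "int p ^ (s - 2) dvd (y + int j * d) mod int p ^ s" using j(2) by (simp add: dvd_mod)
  from lettersD(3)[OF letters[OF jle] this] jle show ?thesis by (intro exI conjI)
qed

text \<open>Write \<open>d = p * e\<close> with \<open>e\<close> prime to \<open>p\<close>. The
  residue modulo \<open>p\<close> stays \<open>y mod p\<close>, while \<open>y div p + j * e\<close>
  runs through all classes modulo \<open>p ^ (s - 2)\<close>. Where the latter vanishes, the term is
  congruent to \<open>y mod p\<close> modulo \<open>p ^ (s - 1)\<close>, and the letters in that
  class lie below \<open>p\<close>.\<close>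

lemma exact_difference_hits_small:
  assumes "int p dvd d" "\<not> (int p)\<^sup>2 dvd d"
  shows "\<exists>j\<le>p ^ (s - 2). (y + int j * d) mod int p ^ s < int p"
proof -
  have pos: "int p > 0" using p by (simp add: prime_gt_0_nat)
  obtain e where e: "d = int p * e" using assms(1) by (rule dvdE)
  have "\<not> int p dvd e" using assms(2) e pos by (auto simp: power2_eq_square)
  then have "coprime (int p) e" using p by (intro prime_imp_coprime) auto
  then have "coprime e (int p ^ (s - 2))" by (simp add: coprime_commute)
  moreover have "int p ^ (s - 2) > 0" using pos by simp
  ultimately obtain j where
    j: "int j < int p ^ (s - 2)" "int p ^ (s - 2) dvd y div int p + int j * e"
    using coprime_hits_class by blast
  have jle: "j \<le> p ^ (s - 2)" using j(1) by (metis less_imp_le of_nat_less_iff of_nat_power)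
  let ?z = "(y + int j * d) mod int p ^ s"
  have "y + int j * d = y mod int p + int p * (y div int p + int j * e)"
    by (simp add: e algebra_simps)
  moreover have "s - 1 = Suc (s - 2)" using s by simp
  then have "int p ^ (s - 1) dvd int p * (y div int p + int j * e)" using j(2) by simp
  ultimately have "(y + int j * d) mod int p ^ (s - 1) = (y mod int p) mod int p ^ (s - 1)"
    by (metis dvdE mod_mult_self2)
  moreover have "int p ^ (s - 1) dvd int p ^ s" by (intro le_imp_power_dvd) simp
  ultimately have "?z mod int p ^ (s - 1) = (y mod int p) mod int p ^ (s - 1)"
    by (simp add: mod_mod_cancel)
  also have "\<dots> \<le> y mod int p" using pos by (intro zmod_le_nonneg_dividend) auto
  also have "\<dots> < int p" using pos by simp
  finally show ?thesis using lettersD(4)[OF letters[OF jle]] jle by blast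
qed

end

section \<open>The group in coordinates, and lower bounds for \<open>r_AP\<close>\<close>

lemma carrier_Zmod_power:
  "m > 0 \<Longrightarrow> carrier (Zmod_power m n) = {..<n} \<rightarrow>\<^sub>E {0..<int m}"
  by (simp add: Zmod_power_def carrier_integer_mod_group)

lemma pow_Zmod_power:
  "i < n \<Longrightarrow> (d [^]\<^bsub>Zmod_power m n\<^esub> (j::nat)) i = (int j * d i) mod int m"
proof (induction j)
  case (Suc j)
  then show ?case by (simp add: Zmod_power_def mod_simps algebra_simps)
qed (simp add: Zmod_power_def)

lemma progression_Zmod_power:
  "i < n \<Longrightarrow> progression (Zmod_power m n) x d j i = (x i + int j * d i) mod int m"
  using pow_Zmod_power[where i = i and n = n and d = d and m = m and j = j]
  by (simp add: progression_def) (simp add: Zmod_power_def mod_simps)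

lemma r_AP_ge:
  assumes "finite (carrier G)" "S \<subseteq> carrier G" "\<not> contains_proper_AP G k S"
  shows "card S \<le> r_AP k G"
  unfolding r_AP_def
proof (rule Max_ge)
  have "{card S |S. S \<subseteq> carrier G \<and> \<not> contains_proper_AP G k S} \<subseteq> card ` Pow (carrier G)" by blast
  then show "finite {card S |S. S \<subseteq> carrier G \<and> \<not> contains_proper_AP G k S}"
    by (rule finite_subset) (use assms(1) in simp)
qed (use assms in blast)

section \<open>Words with prescribed letter counts\<close>

definition letter_counts :: "nat \<Rightarrow> nat \<Rightarrow> (nat \<Rightarrow> int) \<Rightarrow> nat \<times> nat" where
  "letter_counts p n w = (card {i. i < n \<and> w i = 0}, card {i. i < n \<and> w i < int p})"

lemma no_proper_AP_letter_counts:
  assumes p: "prime p" and s: "s \<ge> 3"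
  shows "\<not> contains_proper_AP (Zmod_power (p ^ s) n) (p ^ (s - 2) + 1)
    (letter_counts p n -` {c} \<inter> ({..<n} \<rightarrow>\<^sub>E letters p s))"
proof
  define G where "G = Zmod_power (p ^ s) n"
  define q where "q = p ^ (s - 2)"
  have "p > 0" using p by (rule prime_gt_0_nat)
  have cG: "carrier G = {..<n} \<rightarrow>\<^sub>E {0..<int p ^ s}"
    using carrier_Zmod_power[of "p ^ s" n] \<open>p > 0\<close> by (simp add: G_def)
  assume "contains_proper_AP (Zmod_power (p ^ s) n) (p ^ (s - 2) + 1)
    (letter_counts p n -` {c} \<inter> ({..<n} \<rightarrow>\<^sub>E letters p s))"
  then obtain x d where x: "x \<in> carrier G" and d: "d \<in> carrier G"
    and inj: "inj_on (progression G x d) {..<q + 1}"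
    and S: "progression G x d ` {..<q + 1} \<subseteq> letter_counts p n -` {c} \<inter> ({..<n} \<rightarrow>\<^sub>E letters p s)"
    unfolding contains_proper_AP_def G_def q_def by blast
  define f where "f j = progression G x d j" for j
  have f: "f j i = (x i + int j * d i) mod int p ^ s" if "i < n" for i j
    using progression_Zmod_power[OF that, of "p ^ s"] by (simp add: f_def G_def)
  have f0: "f 0 i = x i" if "i < n" for i
    using f[OF that] x that by (auto simp: cG PiE_iff)
  have fS: "letter_counts p n (f j) = c" "f j \<in> {..<n} \<rightarrow>\<^sub>E letters p s" if "j \<le> q" for j
    using S that by (auto simp: f_def image_subset_iff less_Suc_eq_le)
  have lts: "(x i + int j * d i) mod int p ^ s \<in> letters p s" if "i < n" "j \<le> p ^ (s - 2)" for i j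
    using PiE_mem[OF fS(2)[of j], of i] that unfolding q_def f[OF that(1), symmetric] by simp
  have x0: "x i \<ge> 0" if "i < n" for i using x that by (auto simp: cG PiE_iff)
  have stay: "f j i = x i" if "i < n" "int p ^ s dvd d i" for i j
  proof -
    have "f j i = x i mod int p ^ s" unfolding f[OF that(1)] using that(2) by (simp add: mod_add_eq[symmetric])
    then show ?thesis using f[of i 0] f0[of i] that(1) by simp
  qed
  \<comment> \<open>A coordinate with \<open>R\<close> at the start has zero difference, so it keeps
    \<open>R\<close>. As the numbers of coordinates with \<open>R\<close> are equal, this inclusion
    of coordinate sets is an equality: no coordinate acquires \<open>R\<close> later on.\<close>
  have stays: "f j i = x i" if start: "\<And>i. i < n \<Longrightarrow> R (x i) \<Longrightarrow> int p ^ s dvd d i"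
    and card: "\<And>j. j \<le> q \<Longrightarrow> card {i. i < n \<and> R (f j i)} = card {i. i < n \<and> R (f 0 i)}"
    and j: "j \<le> q" and i: "i < n" "R (f j i)" for R :: "int \<Rightarrow> bool" and i j
  proof -
    have "{i. i < n \<and> R (f 0 i)} = {i. i < n \<and> R (f j i)}"
      by (rule card_subset_eq) (use start stay f0 card[OF j] in auto)
    with i have "R (f 0 i)" by blast
    then show ?thesis using start[OF i(1)] stay[OF i(1)] f0[OF i(1)] by simp
  qed
  have cards: "card {i. i < n \<and> f j i = 0} = card {i. i < n \<and> f 0 i = 0}"
    "card {i. i < n \<and> f j i < int p} = card {i. i < n \<and> f 0 i < int p}" if "j \<le> q" for j
    using fS(1)[OF that] fS(1)[of 0] by (auto simp: letter_counts_def)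
  have p_dvd: "int p dvd d i" if i: "i < n" for i
  proof (rule ccontr)
    assume nd: "\<not> int p dvd d i"
    obtain j where j: "j \<le> q" "f j i = 0"
      using unit_difference_hits_zero[OF p s lts[OF i] nd] f[OF i] by (auto simp: q_def)
    have start: "int p ^ s dvd d i" if "i < n" "x i = 0" for i
      using zero_start_imp_dvd[OF p s lts[OF that(1)] that(2)] .
    have "f j i = x i" by (rule stays[where R = "\<lambda>a. a = 0", OF start cards(1) j(1) i j(2)])
    then have "int p ^ s dvd d i" using start[OF i] j(2) by simp
    moreover have "int p dvd int p ^ s" using s by (simp add: dvd_power)
    ultimately show False using nd dvd_trans by blast
  qed
  have p2_dvd: "(int p)\<^sup>2 dvd d i" if i: "i < n" for i
  proof (rule ccontr)
    assume nd: "\<not> (int p)\<^sup>2 dvd d i"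
    obtain j where j: "j \<le> q" "f j i < int p"
      using exact_difference_hits_small[OF p s lts[OF i] p_dvd[OF i] nd] f[OF i]
      by (auto simp: q_def)
    \<comment> \<open>\<open>small_start_imp_dvd\<close> asks for \<open>p\<close> to divide the
      difference, which is why \<open>p_dvd\<close> comes first.\<close>
    have start: "int p ^ s dvd d i" if "i < n" "x i < int p" for i
      using small_start_imp_dvd[OF p s lts[OF that(1)] x0[OF that(1)] that(2) p_dvd[OF that(1)]] .
    have "f j i = x i"
      by (rule stays[where R = "\<lambda>a. a < int p", OF start cards(2) j(1) i j(2)])
    then have "int p ^ s dvd d i" using start[OF i] j(2) by simp
    moreover have "(int p)\<^sup>2 dvd int p ^ s" using s by (intro le_imp_power_dvd) simp
    ultimately show False using nd dvd_trans by blast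
  qed
  have "f q i = f 0 i" if "i < n" for i
  proof -
    have "s = s - 2 + 2" using s by simp
    then have "int p ^ s = int p ^ (s - 2) * (int p)\<^sup>2" by (metis power_add)
    then have "int p ^ s dvd int q * d i" using p2_dvd[OF that] by (simp add: q_def mult_dvd_mono)
    then show ?thesis unfolding f[OF that] by (simp add: mod_add_eq[symmetric])
  qed
  moreover have "f q \<in> extensional {..<n}" "f 0 \<in> extensional {..<n}"
    using fS(2)[of q] fS(2)[of 0] by (auto simp: PiE_def)
  ultimately have "f q = f 0" by (intro extensionalityI[of _ "{..<n}"]) auto
  then have "q = 0" using inj by (simp add: f_def inj_on_def)
  then show False using \<open>p > 0\<close> by (simp add: q_def)
qed

section \<open>Pigeonhole over the letter counts, and the constants\<close>

theorem theorem3p15: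
  fixes p s m k :: nat
  assumes "prime p" and "s \<ge> 3"
    and "m = p ^ s" and "k = p ^ (s - 2) + 1"
  shows "\<exists>C c :: real. C > 0 \<and> 0 < c \<and> c \<le> real m / 2 \<and>
    (\<forall>n::nat. n \<ge> 1 \<longrightarrow>
       real (r_AP k (Zmod_power m n))
         \<ge> C * ((real m - 2 * real p ^ 2 + 2 * real p) ^ n / real n powr c))"
proof (rule exI[of _ "1/4"], rule exI[of _ 2], intro conjI allI impI)
  have p2: "p \<ge> 2" using assms(1) by (rule prime_ge_2_nat)
  \<comment> \<open>From \<open>m \<ge> 8\<close> the exponent \<open>2\<close> is admissible, being
    at most \<open>m / 2\<close>.\<close>
  have p3: "p ^ 3 \<le> m" unfolding assms(3) using assms(2) p2 by (intro power_increasing) auto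
  have "2 ^ 3 \<le> p ^ 3" using p2 by (intro power_mono) auto
  with p3 have "8 \<le> m" by simp
  then show "(2::real) \<le> real m / 2" by simp
  define a where "a = real m - 2 * real p ^ 2 + 2 * real p"
  \<comment> \<open>Nonnegativity of \<open>a\<close> lets the bound on the alphabet be raised to
    the power \<open>n\<close>.\<close>
  have "real p ^ 3 \<le> real m" using p3 by (metis of_nat_le_iff of_nat_power)
  moreover have "real p ^ 3 - 2 * real p ^ 2 + 2 * real p = real p * ((real p - 1)\<^sup>2 + 1)"
    by (simp add: power2_eq_square power3_eq_cube algebra_simps)
  moreover have "real p * ((real p - 1)\<^sup>2 + 1) \<ge> 0" by simp
  ultimately have a0: "a \<ge> 0" unfolding a_def by linarith
  fix n :: nat
  assume n: "n \<ge> 1"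
  let ?W = "{..<n} \<rightarrow>\<^sub>E letters p s"
  have "card {i. i < n \<and> R i} \<le> n" for R
    using card_mono[of "{..<n}" "{i. i < n \<and> R i}"] by auto
  then have "letter_counts p n \<in> ?W \<rightarrow> {..n} \<times> {..n}"
    by (simp add: letter_counts_def)
  \<comment> \<open>There are \<open>(n + 1)^2\<close> possible pairs of counts; this square is the
    source of the exponent \<open>2\<close>.\<close>
  then have "\<exists>c\<in>{..n} \<times> {..n}.
      card (letter_counts p n -` {c} \<inter> ?W) * card ({..n} \<times> {..n}) \<ge> card ?W"
    by (rule pigeonhole_card) (auto intro: finite_PiE finite_letters)
  then obtain c where
    c: "card (letter_counts p n -` {c} \<inter> ?W) * card ({..n} \<times> {..n}) \<ge> card ?W" by blast
  let ?S = "letter_counts p n -` {c} \<inter> ?W"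
  have m: "m > 0" using \<open>8 \<le> m\<close> by simp
  have "card ?S \<le> r_AP k (Zmod_power m n)"
  proof (rule r_AP_ge)
    show "finite (carrier (Zmod_power m n))" by (simp add: carrier_Zmod_power[OF m] finite_PiE)
    show "?S \<subseteq> carrier (Zmod_power m n)"
      unfolding carrier_Zmod_power[OF m] using letters_subset[of p s] assms(3)
      by (intro le_infI2 PiE_mono) simp
  qed (use no_proper_AP_letter_counts assms in simp)
  moreover have "real (card ?W) \<le> real (card ?S) * (real n + 1)\<^sup>2"
    using of_nat_mono[OF c, where 'a = real]
    by (simp add: card_cartesian_product power2_eq_square algebra_simps)
  moreover have "a ^ n \<le> real (card ?W)"
    using card_letters_ge[OF p2 assms(2)] a0 assms(3) by (simp add: card_PiE a_def power_mono)
  ultimately have "a ^ n \<le> real (r_AP k (Zmod_power m n)) * (real n + 1)\<^sup>2"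
    by (meson mult_right_mono of_nat_mono order_trans zero_le_power2)
  \<comment> \<open>\<open>n + 1 \<le> 2 * n\<close> replaces \<open>(n + 1)^2\<close> by
    \<open>4 * n^2\<close>, whence the constant \<open>1/4\<close>.\<close>
  also have "\<dots> \<le> real (r_AP k (Zmod_power m n)) * (2 * real n)\<^sup>2"
    using n by (intro mult_left_mono power_mono) auto
  finally have "a ^ n \<le> real (r_AP k (Zmod_power m n)) * (4 * (real n)\<^sup>2)" by (simp add: power_mult_distrib)
  then show "1 / 4 * ((real m - 2 * real p ^ 2 + 2 * real p) ^ n / real n powr 2)
      \<le> real (r_AP k (Zmod_power m n))"
    using n unfolding a_def by (simp add: powr_numeral field_simps)
qed auto

end
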